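(* Let $n$, $k$ be integers with $n>k+1>2$, let $G$ be a $k$-edge-maximal graph of order $n$, and let $r\in\mathbb{N}$ with $1\le r\le \left\lfloor \frac{n}{k+2}\right\rfloor$. Then $G$ has $$ m=(n-1)k-\binom{k}{2}r $$ edges if and only if $G$ can be obtained from the disjoint union of $r$ copies of $K_k\vee 2K_1$ and $n-(k+2)r$ copies of $K_1$, that is, from $$ r(K_k\vee 2K_1)\ \cup\ (n-(k+2)r)K_1, $$ by a sequence of proper $k$-edge-joins.
   Context: All graphs are finite and simple; $\mathbb{N}$ is the set of positive integers and $\binom{k}{2}=\frac12k(k-1)$. $tH$ denotes the disjoint union of $t$ copies of $H$. The join $G_1\vee G_2$ has vertex set $V(G_1)\cup V(G_2)$ (disjoint) and edge set $E(G_1)\cup E(G_2)\cup\{xy: x\in V(G_1),y\in V(G_2)\}$. The edge-connectivity $\kappa'(G)$ of a connected graph with at least two vertices is the minimum size of an edge-cut (a set of edges whose removal increases the number of components); $\kappa'(G)=0$ if $G$ is disconnected or $G\cong K_1$. The strength of $G$ is $\overline{\kappa}'(G)=\max_{H\subseteq G}\kappa'(H)$, the maximum over all (nonempty) subgraphs $H$ of $G$. A simple graph $G$ is $k$-edge-maximal if $\overline{\kappa}'(G)\le k$ but $\overline{\kappa}'(G+e)\ge k+1$ for every edge $e\notin E(G)$ (i.e. every edge $e$ of the complement of $G$). $k$-edge-join: for graphs $H_1,H_2$ with disjoint vertex sets and $\max\{|V(H_1)|,|V(H_2)|\}\ge k+1$, a $k$-edge-join of $H_1$ and $H_2$ is a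 simple graph obtained from the disjoint union of $H_1$ and $H_2$ by adding $k$ new (distinct) edges, each joining a vertex of $H_1$ to a vertex of $H_2$. Proper $k$-edge-join: let each of $H_1$ and $H_2$ be either a $k$-edge-maximal graph or $K_1$. A $k$-edge-join of $H_1$ and $H_2$ is proper if the resulting graph is $k$-edge-maximal. A graph is obtained from a disjoint union of graphs by a sequence of proper $k$-edge-joins if, starting from the collection of these graphs, one repeatedly replaces two members of the current collection by a proper $k$-edge-join of them, until a single graph remains (the sequence may be empty if the collection consists of a single graph). *)

theory Defs
  imports Main
begin

datatype 'a graph = Graph (verts: "'a set") (edges: "'a set set")

text \<open>Finite simple graphs; an edge is the two-element set of its ends. The graph without
  vertices is excluded, so every subgraph below is nonempty.\<close>

definition simple_graph :: "'a graph \<Rightarrow> bool" where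
  "simple_graph G \<longleftrightarrow> finite (verts G) \<and> verts G \<noteq> {} \<and>
     (\<forall>e\<in>edges G. e \<subseteq> verts G \<and> card e = 2)"

text \<open>Adequate as an isomorphism notion for graphs satisfying \<^const>\<open>simple_graph\<close>, where every
  edge has the form \<open>{u, v}\<close> with \<open>u\<close> and \<open>v\<close> distinct vertices.\<close>

definition graph_iso :: "'a graph \<Rightarrow> 'b graph \<Rightarrow> bool" where
  "graph_iso G H \<longleftrightarrow> (\<exists>f. bij_betw f (verts G) (verts H) \<and>
     (\<forall>u\<in>verts G. \<forall>v\<in>verts G. {u, v} \<in> edges G \<longleftrightarrow> {f u, f v} \<in> edges H))"

definition subgraph :: "'a graph \<Rightarrow> 'a graph \<Rightarrow> bool" where
  "subgraph H G \<longleftrightarrow> simple_graph H \<and> verts H \<subseteq> verts G \<and> edges H \<subseteq> edges G"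

definition complete_graph :: "nat \<Rightarrow> nat graph" where
  "complete_graph n = Graph {..<n} {e. e \<subseteq> {..<n} \<and> card e = 2}"

definition graph_copies :: "nat \<Rightarrow> 'a graph \<Rightarrow> (nat \<times> 'a) graph" where
  "graph_copies t H = Graph ({..<t} \<times> verts H) (\<Union>i<t. (\<lambda>e. Pair i ` e) ` edges H)"

definition graph_join :: "'a graph \<Rightarrow> 'b graph \<Rightarrow> ('a + 'b) graph" where
  "graph_join G H = Graph (verts G <+> verts H)
     ((\<lambda>e. Inl ` e) ` edges G \<union> (\<lambda>e. Inr ` e) ` edges H \<union>
      {{Inl x, Inr y} | x y. x \<in> verts G \<and> y \<in> verts H})"

definition reachable :: "'a graph \<Rightarrow> ('a \<times> 'a) set" where
  "reachable G = {(u, v). u \<in> verts G \<and> v \<in> verts G \<and> (u, v) \<in> {(x, y). {x, y} \<in> edges G}\<^sup>*}"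

definition connected_graph :: "'a graph \<Rightarrow> bool" where
  "connected_graph G \<longleftrightarrow> verts G \<noteq> {} \<and> (\<forall>u\<in>verts G. \<forall>v\<in>verts G. (u, v) \<in> reachable G)"

definition num_components :: "'a graph \<Rightarrow> nat" where
  "num_components G = card (verts G // reachable G)"

definition edge_cut :: "'a graph \<Rightarrow> 'a set set \<Rightarrow> bool" where
  "edge_cut G F \<longleftrightarrow> F \<subseteq> edges G \<and>
     num_components (Graph (verts G) (edges G - F)) > num_components G"

definition edge_connectivity :: "'a graph \<Rightarrow> nat" where
  "edge_connectivity G =
     (if connected_graph G \<and> card (verts G) \<ge> 2 then Min {card F | F. edge_cut G F} else 0)"

definition strength :: "'a graph \<Rightarrow> nat" where
  "strength G = Max {edge_connectivity H | H. subgraph H G}"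

definition k_edge_maximal :: "nat \<Rightarrow> 'a graph \<Rightarrow> bool" where
  "k_edge_maximal k G \<longleftrightarrow> simple_graph G \<and> strength G \<le> k \<and>
     (\<forall>u\<in>verts G. \<forall>v\<in>verts G. u \<noteq> v \<longrightarrow> {u, v} \<notin> edges G \<longrightarrow>
        strength (Graph (verts G) (insert {u, v} (edges G))) \<ge> k + 1)"

definition edge_join :: "nat \<Rightarrow> 'a graph \<Rightarrow> 'a graph \<Rightarrow> 'a graph \<Rightarrow> bool" where
  "edge_join k H1 H2 H \<longleftrightarrow> simple_graph H1 \<and> simple_graph H2 \<and> verts H1 \<inter> verts H2 = {} \<and>
     max (card (verts H1)) (card (verts H2)) \<ge> k + 1 \<and>
     (\<exists>F. F \<subseteq> {{x, y} | x y. x \<in> verts H1 \<and> y \<in> verts H2} \<and> card F = k \<and>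
        H = Graph (verts H1 \<union> verts H2) (edges H1 \<union> edges H2 \<union> F))"

definition proper_edge_join :: "nat \<Rightarrow> 'a graph \<Rightarrow> 'a graph \<Rightarrow> 'a graph \<Rightarrow> bool" where
  "proper_edge_join k H1 H2 H \<longleftrightarrow>
     (k_edge_maximal k H1 \<or> graph_iso H1 (complete_graph 1)) \<and>
     (k_edge_maximal k H2 \<or> graph_iso H2 (complete_graph 1)) \<and>
     edge_join k H1 H2 H \<and> k_edge_maximal k H"

text \<open>Collections of graphs are sets of graphs with pairwise disjoint vertex sets. Since vertex
  sets are nonempty, two members are never equal, even if they are isomorphic, so no multisets
  are needed.\<close>

definition vertex_disjoint :: "'a graph set \<Rightarrow> bool" where
  "vertex_disjoint C \<longleftrightarrow> pairwise (\<lambda>H1 H2. verts H1 \<inter> verts H2 = {}) C"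

definition proper_join_step :: "nat \<Rightarrow> 'a graph set \<Rightarrow> 'a graph set \<Rightarrow> bool" where
  "proper_join_step k C C' \<longleftrightarrow>
     (\<exists>H1\<in>C. \<exists>H2\<in>C. \<exists>H. H1 \<noteq> H2 \<and> proper_edge_join k H1 H2 H \<and> C' = insert H (C - {H1, H2}))"

text \<open>An edge-join keeps the vertices of its two parts, so the members of the starting collection
  can be taken to live on vertices of the resulting graph: no further isomorphism is needed
  between \<open>G\<close> and the outcome of the joins.\<close>

definition obtained_by_proper_joins :: "nat \<Rightarrow> 'a graph set \<Rightarrow> 'a graph \<Rightarrow> bool" where
  "obtained_by_proper_joins k C G \<longleftrightarrow> vertex_disjoint C \<and> (proper_join_step k)\<^sup>*\<^sup>* C {G}"

definition consists_of_copies :: "nat \<Rightarrow> 'b graph \<Rightarrow> 'a graph set \<Rightarrow> bool" where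
  "consists_of_copies t H C \<longleftrightarrow>
     finite C \<and> card C = t \<and> (\<forall>H'\<in>C. simple_graph H' \<and> graph_iso H' H)"

end

theory Submission
  imports Defs
begin

text \<open>
  Write \<open>Q\<close> for \<open>K\<^sub>k \<or> 2K\<^sub>1\<close>, the complete graph on \<open>k + 2\<close> vertices with one edge
  deleted. Two independent facts give the equivalence.

  Counting. Each join replaces two graphs by one and adds exactly \<open>k\<close> edges, so the total number
  of edges plus \<open>k\<close> times the number of graphs never changes. Hence whatever is joined together
  from \<open>s\<close> copies of \<open>Q\<close> and \<open>n - (k + 2)s\<close> single vertices has \<open>(n - 1)k - binom(k,2) s\<close> edges
  (\<open>edges_of_decomposition\<close>). For \<open>k \<ge> 2\<close> this number determines \<open>s\<close>.

  Decomposition. Every \<open>k\<close>-edge-maximal graph of order at least \<open>k + 2\<close> arises in this way for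
  some \<open>s\<close> (\<open>k_edge_maximal_decomposition\<close>); comparing edge numbers then forces \<open>s = r\<close>.
  The decomposition is found by cutting. As the graph itself has edge-connectivity at most \<open>k\<close>,
  it has a cut with at most \<open>k\<close> edges. A cut with fewer than \<open>k\<close> edges would have to contain all
  pairs across it, because a new edge across it would still leave a cut with at most \<open>k\<close> edges and
  so could not create a more highly connected subgraph; but that is too many pairs. So there is a
  cut with exactly \<open>k\<close> edges, and both of its sides are again \<open>k\<close>-edge-maximal, since a highly
  connected subgraph cannot straddle such a cut (\<open>k_edge_maximal_induced_side\<close>).

  For the induction each side must be a single vertex or of order at least \<open>k + 2\<close>. If some vertex
  has degree \<open>k\<close>, split off that vertex. Otherwise all degrees exceed \<open>k\<close>, and a side with \<open>m\<close>
  vertices, \<open>1 \<le> m \<le> k + 1\<close>, would send out at least \<open>m(k + 2 - m) \<ge> k + 1\<close> edges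
  (\<open>cut_side_large\<close>). The induction ends at order \<open>k + 2\<close>, where \<open>Q\<close> is the only
  \<open>k\<close>-edge-maximal graph: some vertex \<open>u\<close> misses another vertex \<open>v\<close>, and joining any other
  non-adjacent pair would leave \<open>u\<close> with degree at most \<open>k\<close>, whereas a subgraph of
  edge-connectivity above \<open>k\<close> has all degrees above \<open>k\<close> and so all \<open>k + 2\<close> vertices.
\<close>

section \<open>Vertex cuts\<close>

definition cut_edges :: "'a graph \<Rightarrow> 'a set \<Rightarrow> 'a set set" where
  "cut_edges G X = {e \<in> edges G. e \<inter> X \<noteq> {} \<and> e - X \<noteq> {}}"

definition induced :: "'a graph \<Rightarrow> 'a set \<Rightarrow> 'a graph" where
  "induced G X = Graph (verts G \<inter> X) {e \<in> edges G. e \<subseteq> X}"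

abbreviation add_edge :: "'a \<Rightarrow> 'a \<Rightarrow> 'a graph \<Rightarrow> 'a graph" where
  "add_edge u v G \<equiv> Graph (verts G) (insert {u, v} (edges G))"

lemma simple_graph_finite_edges:
  assumes "simple_graph G"
  shows "finite (edges G)"
  using assms unfolding simple_graph_def
  by (meson Pow_iff finite_Pow_iff finite_subset subsetI)

lemma simple_graph_edgeE:
  assumes "simple_graph G" "e \<in> edges G"
  obtains x y where "e = {x, y}" "x \<noteq> y" "x \<in> verts G" "y \<in> verts G"
  using assms unfolding simple_graph_def by (metis card_2_iff insert_subset)

lemma simple_graph_edge_throughE:
  assumes "simple_graph G" "e \<in> edges G" "v \<in> e"
  obtains w where "e = {v, w}" "w \<noteq> v" "w \<in> verts G"
  using simple_graph_edgeE[OF assms(1,2)] assms(3) by (metis insert_commute insertE singletonD)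

lemma finite_cut_edges: "simple_graph G \<Longrightarrow> finite (cut_edges G X)"
  unfolding cut_edges_def by (simp add: simple_graph_finite_edges)

lemma cut_edges_Compl:
  assumes "simple_graph G"
  shows "cut_edges G (verts G - X) = cut_edges G X"
  using assms unfolding cut_edges_def simple_graph_def by blast

lemma simple_graph_add_edge:
  assumes "simple_graph G" "u \<in> verts G" "v \<in> verts G" "u \<noteq> v"
  shows "simple_graph (add_edge u v G)"
  using assms unfolding simple_graph_def by auto

lemma simple_graph_induced:
  assumes "simple_graph G" "verts G \<inter> X \<noteq> {}"
  shows "simple_graph (induced G X)"
  using assms unfolding simple_graph_def induced_def by auto

lemma equiv_reachable: "equiv (verts G) (reachable G)"
proof -
  have "sym ({(x, y). {x, y} \<in> edges G}\<^sup>*)"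
    by (intro sym_rtrancl) (auto simp: sym_def insert_commute)
  then show ?thesis
    unfolding equiv_def refl_on_def sym_def trans_def reachable_def
    by (auto intro: rtrancl_trans)
qed

lemma connected_iff_num_components:
  assumes "verts G \<noteq> {}"
  shows "connected_graph G \<longleftrightarrow> num_components G = 1"
proof
  assume c: "connected_graph G"
  have "reachable G `` {u} = verts G" if "u \<in> verts G" for u
    using c that unfolding connected_graph_def by (auto simp: reachable_def)
  then have "verts G // reachable G = {verts G}"
    using assms unfolding quotient_def by auto
  then show "num_components G = 1" unfolding num_components_def by simp
next
  assume "num_components G = 1"
  then obtain c where c: "verts G // reachable G = {c}"
    unfolding num_components_def by (metis card_1_singletonE)
  have "(u, v) \<in> reachable G" if "u \<in> verts G" "v \<in> verts G" for u v
    using c that quotientI[of _ "verts G" "reachable G"] eq_equiv_class[OF _ equiv_reachable]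
    by (metis singletonD)
  then show "connected_graph G" using assms unfolding connected_graph_def by blast
qed

lemma num_components_pos:
  assumes "finite (verts G)" "verts G \<noteq> {}"
  shows "num_components G \<ge> 1"
proof -
  have "reachable G \<subseteq> verts G \<times> verts G" unfolding reachable_def by auto
  then have "finite (verts G // reachable G)" by (rule finite_quotient[OF assms(1)])
  moreover have "verts G // reachable G \<noteq> {}" using assms(2) unfolding quotient_def by auto
  ultimately show ?thesis unfolding num_components_def
    by (metis One_nat_def Suc_leI card_gt_0_iff)
qed

text \<open>The component of a vertex that does not reach every other vertex has no edge leaving it.\<close>

lemma disconnected_obtains_empty_cut:
  assumes "simple_graph G" "\<not> connected_graph G"
  obtains X where "X \<noteq> {}" "X \<subset> verts G" "cut_edges G X = {}"
proof -
  obtain u v where uv: "u \<in> verts G" "v \<in> verts G" "(u, v) \<notin> reachable G"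
    using assms unfolding connected_graph_def simple_graph_def by blast
  define X where "X = reachable G `` {u}"
  have "u \<in> X" "v \<notin> X" "X \<subseteq> verts G" using uv unfolding X_def reachable_def by auto
  have "e \<subseteq> X" if e: "e \<in> edges G" "e \<inter> X \<noteq> {}" for e
  proof -
    have step: "y \<in> X" if "{x, y} \<in> edges G" "x \<in> X" for x y
    proof -
      have "y \<in> verts G" using that(1) assms(1) unfolding simple_graph_def by auto
      then show ?thesis using that unfolding X_def reachable_def
        by (auto intro: rtrancl_into_rtrancl)
    qed
    obtain x y where "e = {x, y}" using simple_graph_edgeE[OF assms(1) e(1)] by metis
    then show ?thesis using e step[of x y] step[of y x] by (auto simp: insert_commute)
  qed
  then have "cut_edges G X = {}" unfolding cut_edges_def by auto
  then show ?thesis using that[of X] \<open>u \<in> X\<close> \<open>v \<notin> X\<close> \<open>X \<subseteq> verts G\<close> uv by blast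
qed

lemma empty_cut_disconnected:
  assumes "cut_edges G X = {}" "verts G \<inter> X \<noteq> {}" "verts G - X \<noteq> {}"
  shows "\<not> connected_graph G"
proof
  assume c: "connected_graph G"
  obtain u v where uv: "u \<in> verts G" "u \<in> X" "v \<in> verts G" "v \<notin> X" using assms by auto
  then have "(u, v) \<in> {(x, y). {x, y} \<in> edges G}\<^sup>*"
    using c unfolding connected_graph_def reachable_def by auto
  then have "v \<in> X"
    by (induction rule: rtrancl_induct) (use uv assms(1) in \<open>auto simp: cut_edges_def\<close>)
  then show False using uv by simp
qed

section \<open>Edge-connectivity and strength in terms of vertex cuts\<close>

lemma edge_cut_cut_edges:
  assumes "simple_graph G" "connected_graph G" "verts G \<inter> X \<noteq> {}" "verts G - X \<noteq> {}"
  shows "edge_cut G (cut_edges G X)"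
proof -
  define G' where "G' = Graph (verts G) (edges G - cut_edges G X)"
  have ne: "finite (verts G)" "verts G \<noteq> {}" using assms(1) unfolding simple_graph_def by auto
  have "\<not> connected_graph G'"
    by (rule empty_cut_disconnected[of _ X]) (use assms in \<open>auto simp: G'_def cut_edges_def\<close>)
  then have "num_components G' \<noteq> 1"
    using ne connected_iff_num_components[of G'] by (simp add: G'_def)
  moreover have "num_components G' \<ge> 1"
    by (rule num_components_pos) (use ne in \<open>auto simp: G'_def\<close>)
  moreover have "num_components G = 1"
    using connected_iff_num_components[of G] assms(2) ne by simp
  ultimately show ?thesis unfolding edge_cut_def G'_def cut_edges_def by auto
qed

lemma finite_edge_cut_sizes:
  assumes "simple_graph G"
  shows "finite {card F | F. edge_cut G F}"
proof -
  have "{card F | F. edge_cut G F} \<subseteq> card ` Pow (edges G)" unfolding edge_cut_def by auto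
  then show ?thesis using simple_graph_finite_edges[OF assms] finite_subset by blast
qed

text \<open>Together with \<open>edge_connectivity_attained\<close> this replaces numbers of components by vertex sets:
  the edges leaving a vertex set form an edge-cut of a connected graph, and conversely every
  edge-cut of such a graph contains all edges that leave some vertex set.\<close>

lemma edge_connectivity_le_cut:
  assumes "simple_graph G" "verts G \<inter> X \<noteq> {}" "verts G - X \<noteq> {}"
  shows "edge_connectivity G \<le> card (cut_edges G X)"
proof (cases "connected_graph G \<and> card (verts G) \<ge> 2")
  case True
  have "Min {card F | F. edge_cut G F} \<le> card (cut_edges G X)"
    using finite_edge_cut_sizes[OF assms(1)] edge_cut_cut_edges[OF assms(1) _ assms(2,3)] True
    by (auto intro!: Min_le)
  then show ?thesis using True unfolding edge_connectivity_def by simp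
qed (auto simp: edge_connectivity_def)

lemma edge_connectivity_attained:
  assumes G: "simple_graph G" and n: "card (verts G) \<ge> 2"
  obtains X where "X \<noteq> {}" "X \<subset> verts G" "card (cut_edges G X) \<le> edge_connectivity G"
proof (cases "connected_graph G")
  case False
  then show ?thesis using disconnected_obtains_empty_cut[OF G] that by (metis card.empty le0)
next
  case c: True
  have V: "finite (verts G)" "verts G \<noteq> {}" using G unfolding simple_graph_def by auto
  obtain v where v: "v \<in> verts G" using V by auto
  have "verts G - {v} \<noteq> {}" using n card_mono[of "{v}" "verts G"] by auto
  then have "edge_cut G (cut_edges G {v})" using edge_cut_cut_edges[OF G c] v by blast
  then have "{card F | F. edge_cut G F} \<noteq> {}" by auto
  then have "Min {card F | F. edge_cut G F} \<in> {card F | F. edge_cut G F}"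
    using finite_edge_cut_sizes[OF G] Min_in by blast
  then obtain F where F: "edge_cut G F" "card F = edge_connectivity G"
    using c n unfolding edge_connectivity_def by auto
  \<comment> \<open>Removing a minimum edge-cut disconnects the graph, so all edges of \<open>G\<close> that leave a component
    of the rest lie in that edge-cut.\<close>
  define G' where "G' = Graph (verts G) (edges G - F)"
  have "num_components G = 1" using connected_iff_num_components[of G] c V by simp
  then have "\<not> connected_graph G'"
    using F(1) connected_iff_num_components[of G'] V unfolding edge_cut_def G'_def by auto
  moreover have "simple_graph G'" using G unfolding simple_graph_def G'_def by auto
  ultimately obtain X where X: "X \<noteq> {}" "X \<subset> verts G'" "cut_edges G' X = {}"
    using disconnected_obtains_empty_cut by blast
  have "cut_edges G X \<subseteq> F" using X(3) unfolding cut_edges_def G'_def by auto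
  moreover have "finite F"
    using F(1) simple_graph_finite_edges[OF G] finite_subset unfolding edge_cut_def by blast
  ultimately have "card (cut_edges G X) \<le> edge_connectivity G"
    using F(2) card_mono by metis
  then show ?thesis using that[of X] X by (simp add: G'_def)
qed

lemma finite_subgraph_connectivities:
  assumes "simple_graph G"
  shows "finite {edge_connectivity H | H. subgraph H G}"
proof -
  have "{edge_connectivity H | H. subgraph H G}
      \<subseteq> (\<lambda>(V, E). edge_connectivity (Graph V E)) ` (Pow (verts G) \<times> Pow (edges G))"
  proof clarify
    fix H assume "subgraph H G"
    then show "edge_connectivity H
        \<in> (\<lambda>(V, E). edge_connectivity (Graph V E)) ` (Pow (verts G) \<times> Pow (edges G))"
      unfolding subgraph_def by (intro image_eqI[of _ _ "(verts H, edges H)"]) auto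
  qed
  moreover have "finite (verts G)" using assms unfolding simple_graph_def by auto
  ultimately show ?thesis
    using simple_graph_finite_edges[OF assms] finite_subset by blast
qed

lemma edge_connectivity_le_strength:
  assumes "simple_graph G" "subgraph H G"
  shows "edge_connectivity H \<le> strength G"
  unfolding strength_def using assms finite_subgraph_connectivities by (auto intro!: Max_ge)

lemma strength_attained:
  assumes "simple_graph G"
  obtains H where "subgraph H G" "edge_connectivity H = strength G"
proof -
  have "subgraph G G" using assms unfolding subgraph_def by auto
  then have "{edge_connectivity H | H. subgraph H G} \<noteq> {}" by auto
  then have "strength G \<in> {edge_connectivity H | H. subgraph H G}"
    unfolding strength_def using finite_subgraph_connectivities[OF assms] Max_in by blast
  then show ?thesis using that by auto
qed

text \<open>If \<open>H\<close> had vertices on both sides, the edges of the cut that belong to \<open>H\<close> would separate it,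
  and there are too few of them.\<close>

lemma subgraph_on_one_side_of_small_cut:
  assumes "simple_graph G" "subgraph H G" "card (cut_edges G X) < edge_connectivity H"
  shows "verts H \<subseteq> X \<or> verts H \<inter> X = {}"
proof (rule ccontr)
  assume "\<not> ?thesis"
  then have "edge_connectivity H \<le> card (cut_edges H X)"
    using assms(2) unfolding subgraph_def by (intro edge_connectivity_le_cut) auto
  also have "\<dots> \<le> card (cut_edges G X)"
    by (rule card_mono[OF finite_cut_edges[OF assms(1)]])
      (use assms(2) in \<open>auto simp: subgraph_def cut_edges_def\<close>)
  finally show False using assms(3) by simp
qed

text \<open>For a single vertex \<open>v\<close> the number \<open>card (cut_edges G {v})\<close> is its degree.\<close>

lemma card_cut_edges_vertex_less:
  assumes G: "simple_graph G" and v: "v \<in> verts G"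
  shows "card (cut_edges G {v}) < card (verts G)"
proof -
  have fin: "finite (verts G)" using G unfolding simple_graph_def by simp
  have "cut_edges G {v} \<subseteq> (\<lambda>w. {v, w}) ` (verts G - {v})"
  proof
    fix e assume "e \<in> cut_edges G {v}"
    then have "e \<in> edges G" "v \<in> e" unfolding cut_edges_def by auto
    then obtain w where "e = {v, w}" "w \<noteq> v" "w \<in> verts G"
      using simple_graph_edge_throughE[OF G] by metis
    then show "e \<in> (\<lambda>w. {v, w}) ` (verts G - {v})" by auto
  qed
  then have "card (cut_edges G {v}) \<le> card (verts G - {v})"
    using fin by (meson surj_card_le finite_Diff)
  also have "\<dots> < card (verts G)" using fin v by (rule card_Diff1_less)
  finally show ?thesis .
qed

section \<open>Cuts of edge-maximal graphs\<close>

lemma k_edge_maximalD: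
  assumes "k_edge_maximal k G"
  shows "simple_graph G" "subgraph H G \<Longrightarrow> edge_connectivity H \<le> k"
  using assms edge_connectivity_le_strength[of G H] unfolding k_edge_maximal_def by auto

text \<open>The highly connected subgraph must use the new edge, for otherwise \<open>G\<close> contains it already.\<close>

lemma k_edge_maximal_add_edgeE:
  assumes G: "k_edge_maximal k G"
    and uv: "u \<in> verts G" "v \<in> verts G" "u \<noteq> v" "{u, v} \<notin> edges G"
  obtains H where "subgraph H (add_edge u v G)" "k < edge_connectivity H" "{u, v} \<in> edges H"
proof -
  have "simple_graph (add_edge u v G)"
    using simple_graph_add_edge[OF k_edge_maximalD(1)[OF G], of u v] uv by simp
  then obtain H where H: "subgraph H (add_edge u v G)"
    "edge_connectivity H = strength (add_edge u v G)" using strength_attained by blast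
  then have "k < edge_connectivity H" using G uv unfolding k_edge_maximal_def by force
  moreover from this have "{u, v} \<in> edges H"
    using H(1) k_edge_maximalD(2)[OF G, of H] unfolding subgraph_def by fastforce
  ultimately show ?thesis using that H(1) by blast
qed

text \<open>After adding one edge across it, the cut still has at most \<open>k\<close> edges, so a subgraph of
  edge-connectivity above \<open>k\<close> cannot contain both ends of that edge.\<close>

lemma k_edge_maximal_small_cut_complete:
  assumes G: "k_edge_maximal k G" and cut: "card (cut_edges G X) < k"
    and xy: "x \<in> verts G" "x \<in> X" "y \<in> verts G" "y \<notin> X"
  shows "{x, y} \<in> edges G"
proof (rule ccontr)
  assume "{x, y} \<notin> edges G"
  then obtain H where H: "subgraph H (add_edge x y G)" "k < edge_connectivity H" "{x, y} \<in> edges H"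
    using k_edge_maximal_add_edgeE[OF G, of x y] xy by metis
  have s: "simple_graph (add_edge x y G)"
    using simple_graph_add_edge k_edge_maximalD(1)[OF G] xy by metis
  have "card (cut_edges (add_edge x y G) X) \<le> card (insert {x, y} (cut_edges G X))"
    using finite_cut_edges[OF k_edge_maximalD(1)[OF G]]
    by (intro card_mono) (auto simp: cut_edges_def)
  also have "\<dots> \<le> card (cut_edges G X) + 1"
    by (simp add: card_insert_if finite_cut_edges[OF k_edge_maximalD(1)[OF G]])
  also have "\<dots> < edge_connectivity H" using cut H(2) by simp
  finally have "verts H \<subseteq> X \<or> verts H \<inter> X = {}"
    using subgraph_on_one_side_of_small_cut[OF s H(1)] by blast
  moreover have "{x, y} \<subseteq> verts H"
    using H(1,3) unfolding subgraph_def simple_graph_def by blast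
  ultimately show False using xy by auto
qed

text \<open>A smaller cut would contain all \<open>a b\<close> pairs across it, where \<open>a\<close> and \<open>b\<close> are the orders of
  its sides, and \<open>a b \<ge> a + b - 1 \<ge> k\<close>.\<close>

lemma k_edge_maximal_cut_ge:
  assumes G: "k_edge_maximal k G" and n: "k < card (verts G)"
    and X: "X \<noteq> {}" "X \<subset> verts G"
  shows "k \<le> card (cut_edges G X)"
proof (rule ccontr)
  assume "\<not> ?thesis"
  then have small: "card (cut_edges G X) < k" by simp
  have fin: "finite (verts G)" "finite X"
    using k_edge_maximalD(1)[OF G] X finite_subset unfolding simple_graph_def by auto
  let ?Y = "verts G - X"
  have "(\<lambda>(x, y). {x, y}) ` (X \<times> ?Y) \<subseteq> cut_edges G X"
    using k_edge_maximal_small_cut_complete[OF G small] X unfolding cut_edges_def by auto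
  moreover have "inj_on (\<lambda>(x, y). {x, y}) (X \<times> ?Y)"
    by (auto simp: inj_on_def doubleton_eq_iff)
  ultimately have "card (X \<times> ?Y) \<le> card (cut_edges G X)"
    using finite_cut_edges[OF k_edge_maximalD(1)[OF G]] by (metis card_inj_on_le)
  moreover have "card X + card ?Y = card (verts G)"
    using fin X by (simp add: card_Diff_subset card_mono psubset_imp_subset)
  moreover have "card X \<ge> 1" "card ?Y \<ge> 1"
    using fin X by (auto simp: Suc_le_eq card_gt_0_iff)
  moreover have "a + b \<le> a * b + 1" if "a \<ge> 1" "b \<ge> 1" for a b :: nat
    using that by (cases a; cases b) auto
  ultimately show False using small n by (force simp: card_cartesian_product)
qed

text \<open>A highly connected subgraph created by an edge inside \<open>X\<close> cannot straddle the cut and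
  contains that edge, so it lies inside \<open>X\<close>.\<close>

lemma k_edge_maximal_induced_side:
  assumes G: "k_edge_maximal k G" and X: "verts G \<inter> X \<noteq> {}" and cut: "card (cut_edges G X) \<le> k"
  shows "k_edge_maximal k (induced G X)"
  unfolding k_edge_maximal_def
proof (intro conjI ballI impI)
  note sG = k_edge_maximalD(1)[OF G]
  show sI: "simple_graph (induced G X)" using sG X by (rule simple_graph_induced)
  obtain H where H: "subgraph H (induced G X)" "edge_connectivity H = strength (induced G X)"
    using strength_attained[OF sI] by blast
  then show "strength (induced G X) \<le> k"
    using k_edge_maximalD(2)[OF G, of H] unfolding subgraph_def induced_def by auto
next
  note sG = k_edge_maximalD(1)[OF G]
  fix u v assume uv: "u \<in> verts (induced G X)" "v \<in> verts (induced G X)" "u \<noteq> v"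
    "{u, v} \<notin> edges (induced G X)"
  then have uv': "u \<in> verts G" "v \<in> verts G" "{u, v} \<notin> edges G" "u \<in> X" "v \<in> X"
    unfolding induced_def by auto
  then obtain H where H: "subgraph H (add_edge u v G)" "k < edge_connectivity H" "{u, v} \<in> edges H"
    using k_edge_maximal_add_edgeE[OF G, of u v] uv by metis
  have s: "simple_graph (add_edge u v G)" using simple_graph_add_edge[OF sG] uv uv' by metis
  have "cut_edges (add_edge u v G) X = cut_edges G X" using uv' unfolding cut_edges_def by auto
  then have "verts H \<subseteq> X \<or> verts H \<inter> X = {}"
    using subgraph_on_one_side_of_small_cut[OF s H(1), of X] H(2) cut by simp
  moreover have sH: "\<forall>e\<in>edges H. e \<subseteq> verts H"
    using H(1) unfolding subgraph_def simple_graph_def by blast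
  ultimately have "verts H \<subseteq> X" using H(3) uv' by blast
  then have "subgraph H (add_edge u v (induced G X))"
    using H(1) sH unfolding subgraph_def induced_def by auto
  moreover have "simple_graph (add_edge u v (induced G X))"
    using simple_graph_add_edge simple_graph_induced[OF sG X] uv by metis
  ultimately show "k + 1 \<le> strength (add_edge u v (induced G X))"
    using edge_connectivity_le_strength H(2) by fastforce
qed

lemma k_edge_maximal_obtains_k_cut:
  assumes G: "k_edge_maximal k G" and n: "k < card (verts G)" "2 \<le> card (verts G)"
  obtains X where "X \<noteq> {}" "X \<subset> verts G" "card (cut_edges G X) = k"
proof -
  obtain X where X: "X \<noteq> {}" "X \<subset> verts G" "card (cut_edges G X) \<le> edge_connectivity G"
    using edge_connectivity_attained[OF k_edge_maximalD(1)[OF G] n(2)] by blast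
  moreover have "subgraph G G" using k_edge_maximalD(1)[OF G] unfolding subgraph_def by simp
  ultimately show ?thesis
    using that k_edge_maximalD(2)[OF G] k_edge_maximal_cut_ge[OF G n(1) X(1,2)]
    by (meson le_antisym le_trans)
qed

text \<open>A vertex of \<open>X\<close> has at most \<open>card X - 1\<close> neighbours in \<open>X\<close>, so each vertex of \<open>X\<close>
  sends at least \<open>k + 2 - card X\<close> edges out of \<open>X\<close>. For \<open>1 \<le> card X \<le> k + 1\<close> this gives
  \<open>card X * (k + 2 - card X) \<ge> k + 1\<close> edges in the cut.\<close>

lemma cut_side_large:
  assumes G: "simple_graph G" and deg: "\<And>v. v \<in> X \<Longrightarrow> k < card (cut_edges G {v})"
    and X: "X \<noteq> {}" "X \<subseteq> verts G" and cut: "card (cut_edges G X) \<le> k"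
  shows "k + 2 \<le> card X"
proof (rule ccontr)
  assume "\<not> ?thesis"
  then have small: "card X \<le> k + 1" by simp
  have fin: "finite X" using G X finite_subset unfolding simple_graph_def by auto
  define D where "D v = cut_edges G {v} \<inter> cut_edges G X" for v
  have D_ge: "k + 2 - card X \<le> card (D v)" if v: "v \<in> X" for v
  proof -
    have "cut_edges G {v} \<subseteq> (\<lambda>w. {v, w}) ` (X - {v}) \<union> D v"
    proof
      fix e assume e: "e \<in> cut_edges G {v}"
      then have "e \<in> edges G" "v \<in> e" unfolding cut_edges_def by auto
      then obtain w where w: "e = {v, w}" "w \<noteq> v"
        using simple_graph_edge_throughE[OF G] by metis
      then show "e \<in> (\<lambda>w. {v, w}) ` (X - {v}) \<union> D v"
        using e v unfolding D_def cut_edges_def by auto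
    qed
    then have "card (cut_edges G {v}) \<le> card ((\<lambda>w. {v, w}) ` (X - {v}) \<union> D v)"
      using fin finite_cut_edges[OF G] unfolding D_def by (intro card_mono) auto
    also have "\<dots> \<le> card ((\<lambda>w. {v, w}) ` (X - {v})) + card (D v)" by (rule card_Un_le)
    also have "\<dots> \<le> (card X - 1) + card (D v)"
      using fin v card_image_le[of "X - {v}" "\<lambda>w. {v, w}"] by simp
    finally have "card (cut_edges G {v}) \<le> (card X - 1) + card (D v)" .
    moreover have "0 < card X" using fin v by (auto simp: card_gt_0_iff)
    ultimately show ?thesis using deg[OF v] by linarith
  qed
  have disj: "D v \<inter> D w = {}" if "v \<in> X" "w \<in> X" "v \<noteq> w" for v w
  proof (rule ccontr)
    assume "D v \<inter> D w \<noteq> {}"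
    then obtain e where e: "e \<in> D v" "e \<in> D w" by auto
    then have *: "e \<in> edges G" "v \<in> e" "w \<in> e" "e - X \<noteq> {}"
      unfolding D_def cut_edges_def by auto
    then obtain z where "e = {v, z}" using simple_graph_edge_throughE[OF G] by metis
    then show False using * that by auto
  qed
  have "card X * (k + 2 - card X) = (\<Sum>v\<in>X. k + 2 - card X)" by simp
  also have "\<dots> \<le> (\<Sum>v\<in>X. card (D v))" by (intro sum_mono D_ge)
  also have "\<dots> = card (\<Union>v\<in>X. D v)"
    using fin disj finite_cut_edges[OF G] unfolding D_def
    by (subst card_UN_disjoint) auto
  also have "\<dots> \<le> card (cut_edges G X)"
    using finite_cut_edges[OF G] unfolding D_def by (intro card_mono) auto
  finally have "card X * (k + 2 - card X) \<le> k" using cut by simp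
  \<comment> \<open>With \<open>card X = m + 1\<close> and \<open>k = m + l\<close> the product is \<open>(m + 1) * (l + 1) > m + l\<close>.\<close>
  moreover obtain m where m: "card X = Suc m"
    using fin X(1) by (metis card_eq_0_iff not0_implies_Suc)
  moreover obtain l where "k = m + l" using small m le_Suc_ex by auto
  ultimately show False by (simp add: algebra_simps)
qed

text \<open>The cut along which the induction splits a graph. A vertex of degree \<open>k\<close> serves if there is
  one; otherwise any \<open>k\<close>-cut has two large sides.\<close>

lemma k_edge_maximal_obtains_balanced_k_cut:
  assumes G: "k_edge_maximal k G" and n: "k + 2 \<le> card (verts G)"
  obtains X where "X \<noteq> {}" "X \<subset> verts G" "card (cut_edges G X) = k"
    "card X = 1 \<or> k + 2 \<le> card X \<and> k + 2 \<le> card (verts G - X)"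
proof -
  have not_single: "{v} \<noteq> verts G" for v
  proof
    assume "{v} = verts G"
    then have "card {v} = card (verts G)" by simp
    then show False using n by simp
  qed
  show ?thesis
  proof (cases "\<exists>v\<in>verts G. card (cut_edges G {v}) = k")
    case True
    then obtain v where v: "v \<in> verts G" "card (cut_edges G {v}) = k" by blast
    then show ?thesis using that[of "{v}"] not_single[of v] by auto
  next
    case False
    note sG = k_edge_maximalD(1)[OF G]
    have deg: "k < card (cut_edges G {v})" if "v \<in> verts G" for v
    proof -
      have "k \<le> card (cut_edges G {v})"
        by (rule k_edge_maximal_cut_ge[OF G]) (use n that not_single[of v] in auto)
      moreover have "card (cut_edges G {v}) \<noteq> k" using False that by blast
      ultimately show ?thesis by simp
    qed
    obtain X where X: "X \<noteq> {}" "X \<subset> verts G" "card (cut_edges G X) = k"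
      using k_edge_maximal_obtains_k_cut[OF G] n by auto
    have "k + 2 \<le> card X"
      using cut_side_large[OF sG] deg X by (metis order_refl psubsetD psubset_imp_subset)
    moreover have "k + 2 \<le> card (verts G - X)"
      using cut_side_large[OF sG, of "verts G - X" k] deg X cut_edges_Compl[OF sG, of X] by auto
    ultimately show ?thesis using that X by blast
  qed
qed

section \<open>The edge-maximal graph of order \<open>k + 2\<close>\<close>

text \<open>Up to isomorphism this is the complete graph on \<open>k + 2\<close> vertices without one edge; the two
  non-adjacent vertices are \<open>Inr (0, 0)\<close> and \<open>Inr (1, 0)\<close>.\<close>

abbreviation (input) K_minus_edge :: "nat \<Rightarrow> (nat + nat \<times> nat) graph" where
  "K_minus_edge k \<equiv> graph_join (complete_graph k) (graph_copies 2 (complete_graph 1))"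

lemma edges_complete_graph_1: "edges (complete_graph 1) = {}"
  unfolding complete_graph_def by (auto simp: lessThan_Suc card_2_iff)

lemma verts_K_minus_edge:
  "verts (K_minus_edge k) = Inl ` {..<k} \<union> {Inr (0, 0), Inr (1, 0)}"
  unfolding graph_join_def graph_copies_def complete_graph_def
  by (auto simp: Plus_def lessThan_Suc numeral_2_eq_2)

lemma edges_K_minus_edge:
  "edges (K_minus_edge k) = (\<lambda>e. Inl ` e) ` {e. e \<subseteq> {..<k} \<and> card e = 2} \<union>
     (\<lambda>(x, y). {Inl x, Inr y}) ` ({..<k} \<times> {(0, 0), (1, 0)})"
proof -
  have "edges (graph_copies 2 (complete_graph 1)) = {}"
    using edges_complete_graph_1 by (simp add: graph_copies_def)
  moreover have "verts (graph_copies 2 (complete_graph 1)) = {(0, 0), (1, 0)}"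
    unfolding graph_copies_def complete_graph_def by (auto simp: lessThan_Suc numeral_2_eq_2)
  ultimately show ?thesis unfolding graph_join_def by (auto simp: complete_graph_def)
qed

lemma edge_K_minus_edge_iff:
  assumes "a \<in> verts (K_minus_edge k)" "b \<in> verts (K_minus_edge k)"
  shows "{a, b} \<in> edges (K_minus_edge k) \<longleftrightarrow> a \<noteq> b \<and> {a, b} \<noteq> {Inr (0, 0), Inr (1, 0)}"
proof -
  have inl: "{Inl x, Inl y} \<in> edges (K_minus_edge k) \<longleftrightarrow> x \<noteq> y" if "x < k" "y < k" for x y
  proof
    assume "{Inl x, Inl y} \<in> edges (K_minus_edge k)"
    then obtain e where "{Inl x, Inl y} = (Inl ` e :: (nat + nat \<times> nat) set)" "card e = 2"
      unfolding edges_K_minus_edge by (auto simp: doubleton_eq_iff)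
    then have "e = {x, y}" "card e = 2" by (auto simp: set_eq_iff image_iff)
    then show "x \<noteq> y" by auto
  next
    assume "x \<noteq> y"
    then show "{Inl x, Inl y} \<in> edges (K_minus_edge k)"
      using that unfolding edges_K_minus_edge by (intro UnI1 image_eqI[of _ _ "{x, y}"]) auto
  qed
  have inr: "{Inr x, Inr y} \<notin> edges (K_minus_edge k)" for x y
    unfolding edges_K_minus_edge by (auto simp: doubleton_eq_iff)
  have inlr: "{Inl x, Inr y} \<in> edges (K_minus_edge k)" if "x < k" "y = (0, 0) \<or> y = (1, 0)" for x y
    using that unfolding edges_K_minus_edge by auto
  show ?thesis
    using assms inl inr inlr inr[of "(0, 0)" "(0, 0)"] inr[of "(1, 0)" "(1, 0)"]
    unfolding verts_K_minus_edge
    by (auto simp: doubleton_eq_iff insert_commute)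
qed

lemma card_edges_K_minus_edge: "card (edges (K_minus_edge k)) = (k choose 2) + 2 * k"
proof -
  let ?I = "(\<lambda>e. Inl ` e) ` {e. e \<subseteq> {..<k} \<and> card e = 2} :: (nat + nat \<times> nat) set set"
  let ?J = "(\<lambda>(x, y). {Inl x, Inr y}) ` ({..<k} \<times> {(0, 0), (1, 0)}) :: (nat + nat \<times> nat) set set"
  have "card ?I = card {e. e \<subseteq> {..<k} \<and> card e = 2}"
    by (intro card_image inj_onI) (simp add: inj_image_eq_iff)
  then have "card ?I = k choose 2" by (simp add: n_subsets)
  moreover have "inj (\<lambda>(x, y). {Inl x, Inr y} :: (nat + nat \<times> nat) set)"
    by (auto simp: inj_def doubleton_eq_iff)
  then have "card ?J = card ({..<k} \<times> {(0::nat, 0::nat), (1, 0)})"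
    by (intro card_image) (erule inj_on_subset, rule subset_UNIV)
  then have "card ?J = 2 * k" by (simp add: card_cartesian_product)
  moreover have "?I \<inter> ?J = {}" by auto
  moreover have "finite ?I" "finite ?J" by auto
  ultimately show ?thesis unfolding edges_K_minus_edge by (simp add: card_Un_disjoint)
qed

text \<open>A \<open>k\<close>-cut here has a single vertex \<open>u\<close> on one side, which therefore misses exactly one vertex
  \<open>v\<close>. Were another pair \<open>x, y\<close> non-adjacent, joining it would create a subgraph with
  edge-connectivity above \<open>k\<close>. Such a subgraph has all degrees above \<open>k\<close>, hence contains all
  \<open>k + 2\<close> vertices, although \<open>u\<close> still misses \<open>v\<close>.\<close>

lemma k_edge_maximal_order_k_plus_2:
  assumes G: "k_edge_maximal k G" and n: "card (verts G) = k + 2"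
  shows "graph_iso G (K_minus_edge k)"
proof -
  note sG = k_edge_maximalD(1)[OF G]
  have fin: "finite (verts G)" using sG unfolding simple_graph_def by simp
  obtain X where X: "X \<noteq> {}" "X \<subset> verts G" "card (cut_edges G X) = k"
    "card X = 1 \<or> k + 2 \<le> card X \<and> k + 2 \<le> card (verts G - X)"
    using k_edge_maximal_obtains_balanced_k_cut[OF G] n by auto
  have "card X < k + 2" using X n fin psubset_card_mono by metis
  then obtain u where u: "X = {u}" using X(4) by (metis card_1_singletonE leD)
  then have uV: "u \<in> verts G" using X by auto
  have "\<exists>v\<in>verts G - {u}. {u, v} \<notin> edges G"
  proof (rule ccontr)
    assume "\<not> ?thesis"
    then have "(\<lambda>v. {u, v}) ` (verts G - {u}) \<subseteq> cut_edges G {u}" unfolding cut_edges_def by auto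
    moreover have "inj_on (\<lambda>v. {u, v}) (verts G - {u})" by (auto simp: inj_on_def doubleton_eq_iff)
    ultimately have "card (verts G - {u}) \<le> card (cut_edges G {u})"
      using finite_cut_edges[OF sG] by (metis card_inj_on_le)
    then show False using X(3) u n fin uV by simp
  qed
  then obtain v where v: "v \<in> verts G" "v \<noteq> u" "{u, v} \<notin> edges G" by blast
  have full: "{x, y} \<in> edges G" if xy: "x \<in> verts G" "y \<in> verts G" "x \<noteq> y" "{x, y} \<noteq> {u, v}" for x y
  proof (rule ccontr)
    assume "{x, y} \<notin> edges G"
    then obtain H where H: "subgraph H (add_edge x y G)" "k < edge_connectivity H"
      using k_edge_maximal_add_edgeE[OF G, of x y] xy by metis
    have sH: "simple_graph H" and VH: "verts H \<subseteq> verts G" and EH: "edges H \<subseteq> insert {x, y} (edges G)"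
      using H(1) unfolding subgraph_def by auto
    have bound: "k < card (cut_edges H {w})" if "w \<in> verts H" for w
    proof -
      have "card (verts H) \<ge> 2" using H(2) unfolding edge_connectivity_def by (auto split: if_splits)
      then have "verts H - {w} \<noteq> {}" using card_mono[of "{w}" "verts H"] by auto
      then show ?thesis using edge_connectivity_le_cut[OF sH, of "{w}"] that H(2) by auto
    qed
    obtain w where w: "w \<in> verts H" using sH unfolding simple_graph_def by blast
    then have "k + 2 \<le> card (verts H)"
      using bound[OF w] card_cut_edges_vertex_less[OF sH w] by linarith
    then have VHG: "verts H = verts G" using VH fin n by (metis card_seteq)
    have "cut_edges H {u} \<subseteq> (\<lambda>z. {u, z}) ` (verts G - {u, v})"
    proof
      fix e assume "e \<in> cut_edges H {u}"
      then have e: "e \<in> edges H" "u \<in> e" unfolding cut_edges_def by auto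
      then obtain z where z: "e = {u, z}" "z \<noteq> u" "z \<in> verts H"
        using simple_graph_edge_throughE[OF sH] by metis
      moreover have "z \<noteq> v" using e z EH v xy by blast
      ultimately show "e \<in> (\<lambda>z. {u, z}) ` (verts G - {u, v})" using VH by auto
    qed
    then have "card (cut_edges H {u}) \<le> card (verts G - {u, v})"
      using fin by (meson surj_card_le finite_Diff)
    also have "\<dots> = k" using fin n uV v by (simp add: card_Diff_subset)
    finally show False using bound[of u] VHG uV by simp
  qed
  have "card (verts G - {u, v}) = card (Inl ` {..<k} :: (nat + nat \<times> nat) set)"
    using fin n uV v by (simp add: card_Diff_subset card_image)
  then obtain g where g: "bij_betw g (verts G - {u, v}) (Inl ` {..<k} :: (nat + nat \<times> nat) set)"
    using fin by (metis finite_Diff finite_imageI finite_lessThan finite_same_card_bij)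
  define f where "f z = (if z = u then Inr (0, 0) else if z = v then Inr (1, 0) else g z)" for z
  have "bij_betw f (verts G - {u, v}) (Inl ` {..<k})"
    using g by (rule bij_betw_cong[THEN iffD1, rotated]) (auto simp: f_def)
  moreover have "bij_betw f {u, v} {Inr (0, 0), Inr (1, 0)}"
    using v unfolding f_def bij_betw_def by auto
  ultimately have "bij_betw f ((verts G - {u, v}) \<union> {u, v})
      (Inl ` {..<k} \<union> {Inr (0, 0), Inr (1, 0)})"
    by (rule bij_betw_combine) auto
  moreover have "(verts G - {u, v}) \<union> {u, v} = verts G" using uV v by auto
  ultimately have f: "bij_betw f (verts G) (verts (K_minus_edge k))"
    unfolding verts_K_minus_edge by simp
  then have inj: "inj_on f (verts G)" and im: "f ` verts G = verts (K_minus_edge k)"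
    unfolding bij_betw_def by auto
  have "{x, y} \<in> edges G \<longleftrightarrow> {f x, f y} \<in> edges (K_minus_edge k)"
    if xy: "x \<in> verts G" "y \<in> verts G" for x y
  proof -
    have "{x, y} \<in> edges G \<longleftrightarrow> x \<noteq> y \<and> {x, y} \<noteq> {u, v}"
      using full[OF xy] v(3) sG unfolding simple_graph_def by fastforce
    also have "\<dots> \<longleftrightarrow> f x \<noteq> f y \<and> f ` {x, y} \<noteq> f ` {u, v}"
      using inj xy uV v inj_on_image_eq_iff[OF inj, of "{x, y}" "{u, v}"] by (auto simp: inj_on_eq_iff)
    also have "\<dots> \<longleftrightarrow> f x \<noteq> f y \<and> {f x, f y} \<noteq> {Inr (0, 0), Inr (1, 0)}"
    proof -
      have "f ` {x, y} = {f x, f y}" "f ` {u, v} = {Inr (0, 0), Inr (1, 0)}"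
        using v by (auto simp: f_def)
      then show ?thesis by (simp only:)
    qed
    also have "\<dots> \<longleftrightarrow> {f x, f y} \<in> edges (K_minus_edge k)"
      using edge_K_minus_edge_iff[of "f x" k "f y"] im xy by blast
    finally show ?thesis .
  qed
  then show ?thesis using f unfolding graph_iso_def by blast
qed

section \<open>Decomposition by proper joins\<close>

lemma edge_join_of_k_cut:
  assumes G: "simple_graph G" and X: "X \<noteq> {}" "X \<subset> verts G" and cut: "card (cut_edges G X) = k"
    and large: "k + 1 \<le> max (card X) (card (verts G - X))"
  shows "edge_join k (induced G X) (induced G (verts G - X)) G"
proof -
  let ?Y = "verts G - X"
  have V: "verts (induced G X) = X" "verts (induced G ?Y) = ?Y"
    using X unfolding induced_def by auto
  have "cut_edges G X \<subseteq> {{x, y} | x y. x \<in> X \<and> y \<in> ?Y}"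
  proof
    fix e assume "e \<in> cut_edges G X"
    then have e: "e \<in> edges G" "e \<inter> X \<noteq> {}" "e - X \<noteq> {}" unfolding cut_edges_def by auto
    obtain x y where xy: "e = {x, y}" "x \<in> verts G" "y \<in> verts G"
      using simple_graph_edgeE[OF G e(1)] by metis
    show "e \<in> {{x, y} | x y. x \<in> X \<and> y \<in> ?Y}"
    proof (cases "x \<in> X")
      case True
      then show ?thesis using e xy by blast
    next
      case False
      then have "y \<in> X" "e = {y, x}" using e xy by auto
      then show ?thesis using False xy by blast
    qed
  qed
  moreover have "edges G = edges (induced G X) \<union> edges (induced G ?Y) \<union> cut_edges G X"
    using G unfolding induced_def cut_edges_def simple_graph_def by auto
  then have "G = Graph (X \<union> ?Y) (edges (induced G X) \<union> edges (induced G ?Y) \<union> cut_edges G X)"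
    using X by (metis Un_Diff_cancel graph.collapse psubset_imp_subset subset_Un_eq)
  moreover have "simple_graph (induced G X)" "simple_graph (induced G ?Y)"
    using X by (auto intro!: simple_graph_induced[OF G])
  ultimately show ?thesis using V cut large unfolding edge_join_def by auto
qed

text \<open>Joins can be carried out in the presence of bystanders \<open>D\<close>, so that the two sides of a cut
  can be assembled one after the other. A step removes the two graphs that it joins; since the
  bystanders live on the vertex set \<open>W\<close> and the graphs to be joined stay away from it, no bystander
  is removed.\<close>

lemma proper_join_steps_Un:
  assumes "(proper_join_step k)\<^sup>*\<^sup>* C C'"
    and "\<forall>H\<in>C. verts H \<noteq> {} \<and> verts H \<inter> W = {}" and "\<forall>H\<in>D. verts H \<subseteq> W"
  shows "(proper_join_step k)\<^sup>*\<^sup>* (C \<union> D) (C' \<union> D) \<and> (\<forall>H\<in>C'. verts H \<noteq> {} \<and> verts H \<inter> W = {})"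
  using assms(1)
proof (induction rule: rtranclp_induct)
  case base
  then show ?case using assms(2) by simp
next
  case (step C1 C2)
  then obtain H1 H2 H where H: "H1 \<in> C1" "H2 \<in> C1" "H1 \<noteq> H2" "proper_edge_join k H1 H2 H"
    "C2 = insert H (C1 - {H1, H2})" unfolding proper_join_step_def by blast
  have inv: "\<forall>H\<in>C1. verts H \<noteq> {} \<and> verts H \<inter> W = {}" using step.IH by blast
  then have "H1 \<notin> D" "H2 \<notin> D" using assms(3) H(1,2) by blast+
  then have "C2 \<union> D = insert H ((C1 \<union> D) - {H1, H2})" using H(5) by blast
  then have "proper_join_step k (C1 \<union> D) (C2 \<union> D)"
    using H unfolding proper_join_step_def by blast
  then have "(proper_join_step k)\<^sup>*\<^sup>* (C \<union> D) (C2 \<union> D)" using step.IH by auto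
  moreover have "verts H = verts H1 \<union> verts H2"
    using H(4) unfolding proper_edge_join_def edge_join_def by auto
  then have "\<forall>H\<in>C2. verts H \<noteq> {} \<and> verts H \<inter> W = {}" using inv H by auto
  ultimately show ?case by blast
qed

lemma consists_of_copies_Un:
  assumes "consists_of_copies s H A" "consists_of_copies t H B" "A \<inter> B = {}"
  shows "consists_of_copies (s + t) H (A \<union> B)"
  using assms unfolding consists_of_copies_def by (auto simp: card_Un_disjoint)

text \<open>Order \<open>1\<close> is included because one side of the cut may be a single vertex. The subset clause
  keeps the pieces from the two sides apart in the induction.\<close>

lemma k_edge_maximal_decomposition:
  fixes G :: "'a graph"
  assumes "k_edge_maximal k G" and "card (verts G) = 1 \<or> k + 2 \<le> card (verts G)"
  shows "\<exists>A B s t. consists_of_copies s (K_minus_edge k) A \<and> consists_of_copies t (complete_graph 1) B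
     \<and> A \<inter> B = {} \<and> card (verts G) = (k + 2) * s + t \<and> (\<forall>H\<in>A \<union> B. verts H \<subseteq> verts G)
     \<and> obtained_by_proper_joins k (A \<union> B) G"
  using assms
proof (induction "card (verts G)" arbitrary: G rule: less_induct)
  case less
  note G = less.prems(1)
  note sG = k_edge_maximalD(1)[OF G]
  have fin: "finite (verts G)" using sG unfolding simple_graph_def by simp
  have triv: "obtained_by_proper_joins k {G} G"
    unfolding obtained_by_proper_joins_def vertex_disjoint_def by simp
  consider "card (verts G) = 1" | "card (verts G) = k + 2" | "k + 3 \<le> card (verts G)"
    using less.prems(2) by linarith
  then show ?case
  proof cases
    case 1
    then obtain a where a: "verts G = {a}" by (metis card_1_singletonE)
    have "{a} \<notin> edges G" using sG unfolding simple_graph_def by auto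
    then have "graph_iso G (complete_graph 1)"
      unfolding graph_iso_def edges_complete_graph_1
      by (intro exI[of _ "\<lambda>_. 0"]) (auto simp: a complete_graph_def bij_betw_def)
    then have "consists_of_copies 1 (complete_graph 1) {G}"
      using sG unfolding consists_of_copies_def by simp
    moreover have "consists_of_copies 0 (K_minus_edge k) ({} :: 'a graph set)"
      unfolding consists_of_copies_def by simp
    ultimately show ?thesis using triv 1
      by (intro exI[of _ "{}"] exI[of _ "{G}"] exI[of _ 0] exI[of _ 1]) auto
  next
    case 2
    then have "consists_of_copies 1 (K_minus_edge k) {G}"
      using sG k_edge_maximal_order_k_plus_2[OF G] unfolding consists_of_copies_def by simp
    moreover have "consists_of_copies 0 (complete_graph 1) ({} :: 'a graph set)"
      unfolding consists_of_copies_def by simp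
    ultimately show ?thesis using triv 2
      by (intro exI[of _ "{G}"] exI[of _ "{}"] exI[of _ 1] exI[of _ 0]) auto
  next
    case 3
    obtain X where X: "X \<noteq> {}" "X \<subset> verts G" "card (cut_edges G X) = k"
      "card X = 1 \<or> k + 2 \<le> card X \<and> k + 2 \<le> card (verts G - X)"
      using k_edge_maximal_obtains_balanced_k_cut[OF G] 3 by auto
    define Y where "Y = verts G - X"
    define G1 where "G1 = induced G X"
    define G2 where "G2 = induced G Y"
    have V: "verts G1 = X" "verts G2 = Y" using X unfolding G1_def G2_def Y_def induced_def by auto
    have finX: "finite X" using fin X finite_subset by blast
    have cards: "card X + card Y = card (verts G)"
      using X finX fin by (simp add: Y_def card_Diff_subset card_mono psubset_imp_subset)
    have Xpos: "0 < card X" using X(1) finX by auto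
    have Ypos: "0 < card Y" using X(2) fin by (auto simp: Y_def card_gt_0_iff)
    have large: "k + 2 \<le> card Y" using X(4) cards 3 by (auto simp: Y_def)
    have G1: "k_edge_maximal k G1"
      unfolding G1_def using X by (intro k_edge_maximal_induced_side[OF G]) auto
    have G2: "k_edge_maximal k G2"
      unfolding G2_def Y_def using X cut_edges_Compl[OF sG, of X]
      by (intro k_edge_maximal_induced_side[OF G]) auto
    obtain A1 B1 s1 t1 where 1: "consists_of_copies s1 (K_minus_edge k) A1"
      "consists_of_copies t1 (complete_graph 1) B1" "A1 \<inter> B1 = {}" "card X = (k + 2) * s1 + t1"
      "\<forall>H\<in>A1 \<union> B1. verts H \<subseteq> X" "obtained_by_proper_joins k (A1 \<union> B1) G1"
      using less.hyps[OF _ G1] X(4) cards Ypos V by auto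
    obtain A2 B2 s2 t2 where 2: "consists_of_copies s2 (K_minus_edge k) A2"
      "consists_of_copies t2 (complete_graph 1) B2" "A2 \<inter> B2 = {}" "card Y = (k + 2) * s2 + t2"
      "\<forall>H\<in>A2 \<union> B2. verts H \<subseteq> Y" "obtained_by_proper_joins k (A2 \<union> B2) G2"
      using less.hyps[OF _ G2] large cards Xpos V by auto
    have XY: "X \<inter> Y = {}" unfolding Y_def by auto
    have ne: "\<forall>H\<in>A1 \<union> B1 \<union> A2 \<union> B2. verts H \<noteq> {}"
      using 1(1,2) 2(1,2) unfolding consists_of_copies_def simple_graph_def by auto
    have "(A1 \<union> B1) \<inter> (A2 \<union> B2) = {}"
    proof (rule equals0I)
      fix H assume H: "H \<in> (A1 \<union> B1) \<inter> (A2 \<union> B2)"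
      have "verts H \<subseteq> X" "verts H \<subseteq> Y" "verts H \<noteq> {}" using H 1(5) 2(5) ne by blast+
      then show False using XY by blast
    qed
    then have disj: "A1 \<inter> A2 = {}" "B1 \<inter> B2 = {}" "(A1 \<union> A2) \<inter> (B1 \<union> B2) = {}"
      using 1(3) 2(3) by auto
    have vd: "vertex_disjoint ((A1 \<union> B1) \<union> (A2 \<union> B2))"
      using 1(5,6) 2(5,6) XY unfolding obtained_by_proper_joins_def vertex_disjoint_def pairwise_def
      by (smt (verit) Int_commute Un_iff disjoint_iff subset_iff)
    have s1: "(proper_join_step k)\<^sup>*\<^sup>* ((A1 \<union> B1) \<union> (A2 \<union> B2)) ({G1} \<union> (A2 \<union> B2))"
      using proper_join_steps_Un[of k "A1 \<union> B1" "{G1}" Y "A2 \<union> B2"] 1(5,6) 2(5) ne XY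
      unfolding obtained_by_proper_joins_def by blast
    have s2: "(proper_join_step k)\<^sup>*\<^sup>* ((A2 \<union> B2) \<union> {G1}) ({G2} \<union> {G1})"
      using proper_join_steps_Un[of k "A2 \<union> B2" "{G2}" X "{G1}"] 2(5,6) ne XY V
      unfolding obtained_by_proper_joins_def by blast
    have "edge_join k G1 G2 G"
      unfolding G1_def G2_def Y_def
      by (rule edge_join_of_k_cut[OF sG X(1-3)]) (use large in \<open>auto simp: Y_def\<close>)
    then have "proper_edge_join k G1 G2 G" using G G1 G2 unfolding proper_edge_join_def by blast
    moreover have "G1 \<noteq> G2" using V XY X(1) by auto
    ultimately have "proper_join_step k ({G2} \<union> {G1}) {G}"
      unfolding proper_join_step_def by blast
    then have "(proper_join_step k)\<^sup>*\<^sup>* ((A1 \<union> B1) \<union> (A2 \<union> B2)) {G}"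
      using s1 s2 by (simp add: Un_commute)
    then have "obtained_by_proper_joins k ((A1 \<union> A2) \<union> (B1 \<union> B2)) G"
      using vd unfolding obtained_by_proper_joins_def by (simp add: Un_ac)
    moreover have "card (verts G) = (k + 2) * (s1 + s2) + (t1 + t2)"
      using cards 1(4) 2(4) by (simp add: algebra_simps)
    moreover have "\<forall>H\<in>(A1 \<union> A2) \<union> (B1 \<union> B2). verts H \<subseteq> verts G"
      using 1(5) 2(5) X(2) unfolding Y_def by blast
    ultimately show ?thesis
      using consists_of_copies_Un[OF 1(1) 2(1) disj(1)] consists_of_copies_Un[OF 1(2) 2(2) disj(2)]
        disj(3) by blast
  qed
qed

section \<open>Counting edges along joins\<close>

lemma edge_join_card_edges:
  assumes "edge_join k H1 H2 H"
  shows "card (edges H) = card (edges H1) + card (edges H2) + k"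
proof -
  obtain F where s: "simple_graph H1" "simple_graph H2" and d: "verts H1 \<inter> verts H2 = {}"
    and F: "F \<subseteq> {{x, y} | x y. x \<in> verts H1 \<and> y \<in> verts H2}" "card F = k"
    and H: "H = Graph (verts H1 \<union> verts H2) (edges H1 \<union> edges H2 \<union> F)"
    using assms unfolding edge_join_def by blast
  have sub: "\<forall>e\<in>edges H1. e \<subseteq> verts H1 \<and> e \<noteq> {}" "\<forall>e\<in>edges H2. e \<subseteq> verts H2 \<and> e \<noteq> {}"
    using s unfolding simple_graph_def by fastforce+
  have "{{x, y} | x y. x \<in> verts H1 \<and> y \<in> verts H2} = (\<lambda>(x, y). {x, y}) ` (verts H1 \<times> verts H2)"
    by auto
  then have "finite F" using F(1) s finite_subset unfolding simple_graph_def by fastforce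
  moreover have "edges H1 \<inter> edges H2 = {}" using sub d by fastforce
  then have "card (edges H1 \<union> edges H2) = card (edges H1) + card (edges H2)"
    using s by (intro card_Un_disjoint simple_graph_finite_edges)
  moreover have "\<exists>x\<in>verts H1. \<exists>y\<in>verts H2. e = {x, y}" if "e \<in> F" for e
    using F(1) that by blast
  then have "(edges H1 \<union> edges H2) \<inter> F = {}" using sub d by fastforce
  ultimately show ?thesis
    using simple_graph_finite_edges[OF s(1)] simple_graph_finite_edges[OF s(2)] F(2) H
      card_Un_disjoint[of "edges H1 \<union> edges H2" F] by simp
qed

text \<open>The invariant behind the edge count. Disjoint vertex sets matter here because collections are
  sets: they guarantee that the joined graph is not a member already, so that the number of graphs
  drops by exactly one.\<close>

lemma proper_join_steps_edges:
  assumes "(proper_join_step k)\<^sup>*\<^sup>* C C'" and "finite C" "vertex_disjoint C"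
    and "\<forall>H\<in>C. simple_graph H"
  shows "finite C' \<and> vertex_disjoint C' \<and> (\<forall>H\<in>C'. simple_graph H) \<and>
    (\<Sum>H\<in>C'. card (edges H)) + k * card C' = (\<Sum>H\<in>C. card (edges H)) + k * card C"
  using assms(1)
proof (induction rule: rtranclp_induct)
  case base
  then show ?case using assms by simp
next
  case (step C1 C2)
  then obtain H1 H2 H where H: "H1 \<in> C1" "H2 \<in> C1" "H1 \<noteq> H2" "proper_edge_join k H1 H2 H"
    and C2: "C2 = insert H (C1 - {H1, H2})" unfolding proper_join_step_def by blast
  define D where "D = C1 - {H1, H2}"
  have inv: "finite C1" "vertex_disjoint C1" "\<forall>H\<in>C1. simple_graph H" using step.IH by auto
  have join: "edge_join k H1 H2 H" "simple_graph H"
    using H(4) unfolding proper_edge_join_def k_edge_maximal_def by auto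
  have VH: "verts H = verts H1 \<union> verts H2" using join(1) unfolding edge_join_def by auto
  have apart: "verts H \<inter> verts K = {}" if "K \<in> D" for K
    using inv(2) H(1,2) that unfolding VH D_def vertex_disjoint_def pairwise_def by blast
  have "pairwise (\<lambda>H1 H2. verts H1 \<inter> verts H2 = {}) D"
    using inv(2) unfolding vertex_disjoint_def by (rule pairwise_subset) (simp add: D_def)
  then have "vertex_disjoint C2"
    using apart unfolding C2 D_def[symmetric] vertex_disjoint_def
    by (auto simp: pairwise_insert Int_commute)
  moreover have "H \<notin> D" using apart[of H] join(2) unfolding simple_graph_def by auto
  then have "(\<Sum>K\<in>C2. card (edges K)) = card (edges H) + (\<Sum>K\<in>D. card (edges K))"
    "card C2 = Suc (card D)"
    using inv(1) unfolding C2 D_def by auto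
  moreover have C1: "C1 = insert H1 (insert H2 D)" "H2 \<notin> D" "H1 \<notin> insert H2 D" "finite D"
    using H(1-3) inv(1) unfolding D_def by auto
  then have "(\<Sum>K\<in>C1. card (edges K)) = card (edges H1) + (card (edges H2) + (\<Sum>K\<in>D. card (edges K)))"
    "card C1 = Suc (Suc (card D))"
    unfolding C1(1) using C1(2-4) by auto
  ultimately show ?case
    using step.IH inv join edge_join_card_edges[OF join(1)] by (auto simp: C2)
qed

text \<open>An isomorphism speaks only of pairs of vertices; the condition on \<open>H'\<close> makes every edge of
  \<open>H'\<close> such a pair, so that edges correspond to edges.\<close>

lemma graph_iso_card_edges:
  assumes H: "simple_graph H" and H': "\<forall>e\<in>edges H'. \<exists>x\<in>verts H'. \<exists>y\<in>verts H'. e = {x, y}"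
    and iso: "graph_iso H H'"
  shows "card (edges H) = card (edges H')"
proof -
  obtain f where f: "bij_betw f (verts H) (verts H')"
    and e: "\<And>u v. u \<in> verts H \<Longrightarrow> v \<in> verts H \<Longrightarrow> {u, v} \<in> edges H \<longleftrightarrow> {f u, f v} \<in> edges H'"
    using iso unfolding graph_iso_def by blast
  have inj: "inj_on f (verts H)" and im: "f ` verts H = verts H'" using f unfolding bij_betw_def by auto
  have "inj_on ((`) f) (edges H)"
    using inj H unfolding simple_graph_def inj_on_def by (metis inj inj_on_image_eq_iff)
  moreover have "(`) f ` edges H = edges H'"
  proof (intro equalityI subsetI)
    fix d assume "d \<in> (`) f ` edges H"
    then obtain c where c: "c \<in> edges H" "d = f ` c" by auto
    obtain x y where "c = {x, y}" "x \<in> verts H" "y \<in> verts H"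
      using simple_graph_edgeE[OF H c(1)] by metis
    then show "d \<in> edges H'" using c e by simp
  next
    fix d assume d: "d \<in> edges H'"
    then obtain x y where xy: "d = {f x, f y}" "x \<in> verts H" "y \<in> verts H"
      using H' im by (metis imageE)
    then have "{x, y} \<in> edges H" using d e by blast
    then show "d \<in> (`) f ` edges H" unfolding xy(1)
      by (intro image_eqI[of _ _ "{x, y}"]) simp_all
  qed
  ultimately show ?thesis by (metis card_image)
qed

lemma twice_choose_two: "2 * (k choose 2) + k = k * k"
proof (induction k)
  case (Suc k)
  have "Suc k choose 2 = k + (k choose 2)" by (simp add: numeral_2_eq_2)
  then show ?case using Suc.IH by simp
qed simp

text \<open>The invariant gives \<open>e + k = s * (binom(k,2) + 2k) + k * (s + t)\<close> for the number \<open>e\<close> of edges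
  of the final graph, and \<open>k * k = 2 * binom(k,2) + k\<close> turns this into the stated form.\<close>

lemma edges_of_decomposition:
  assumes A: "consists_of_copies s (K_minus_edge k) A"
    and B: "consists_of_copies t (complete_graph 1) B"
    and AB: "A \<inter> B = {}" and G: "obtained_by_proper_joins k (A \<union> B) G"
  shows "int (card (edges G)) = (int ((k + 2) * s + t) - 1) * int k - int (k choose 2) * int s"
proof -
  have eA: "card (edges H) = (k choose 2) + 2 * k" if "H \<in> A" for H
  proof -
    have "\<exists>x\<in>verts (K_minus_edge k). \<exists>y\<in>verts (K_minus_edge k). e = {x, y}"
      if e: "e \<in> edges (K_minus_edge k)" for e
    proof -
      from e have "(\<exists>d. d \<subseteq> {..<k} \<and> card d = 2 \<and> e = Inl ` d) \<or>
          (\<exists>x y. x < k \<and> y \<in> {(0, 0), (1, 0)} \<and> e = {Inl x, Inr y})"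
        unfolding edges_K_minus_edge by blast
      then show ?thesis
      proof (elim disjE exE conjE)
        fix d assume d: "d \<subseteq> {..<k}" "card d = 2" "e = Inl ` d"
        then obtain x y where "d = {x, y}" by (meson card_2_iff)
        then show ?thesis using d unfolding verts_K_minus_edge by auto
      next
        fix x y assume "x < k" "y \<in> {(0, 0), (1, 0)}" "e = {Inl x, Inr y}"
        then show ?thesis unfolding verts_K_minus_edge by blast
      qed
    qed
    then show ?thesis
      using A that graph_iso_card_edges[of H "K_minus_edge k"] card_edges_K_minus_edge[of k]
      unfolding consists_of_copies_def by metis
  qed
  have eB: "card (edges H) = 0" if "H \<in> B" for H
    using B that graph_iso_card_edges[of H "complete_graph 1"] edges_complete_graph_1
    unfolding consists_of_copies_def by auto
  have fin: "finite A" "finite B" "card A = s" "card B = t"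
    using A B unfolding consists_of_copies_def by auto
  have "(\<Sum>H\<in>{G}. card (edges H)) + k * card {G}
      = (\<Sum>H\<in>A \<union> B. card (edges H)) + k * card (A \<union> B)"
    using proper_join_steps_edges[of k "A \<union> B" "{G}"] G A B
    unfolding obtained_by_proper_joins_def consists_of_copies_def by auto
  then have "card (edges G) + k = s * ((k choose 2) + 2 * k) + k * (s + t)"
    using fin AB eA eB by (simp add: sum.union_disjoint card_Un_disjoint)
  from arg_cong[where f = int, OF this]
  have "int (card (edges G)) + int k
      = int s * (int (k choose 2) + 2 * int k) + int k * (int s + int t)"
    by simp
  moreover from arg_cong[where f = int, OF twice_choose_two[of k]]
  have "int k * int k = 2 * int (k choose 2) + int k" by simp
  then have "int s * (int k * int k) = int s * (2 * int (k choose 2) + int k)" by simp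
  ultimately show ?thesis by (simp add: algebra_simps)
qed

theorem theorem1p7:
  fixes n k r :: nat and G :: "'a graph"
  assumes "n > k + 1" and "k + 1 > 2"
    and "k_edge_maximal k G" and "card (verts G) = n"
    and "1 \<le> r" and "r \<le> n div (k + 2)"
  shows "int (card (edges G)) = (int n - 1) * int k - int (k choose 2) * int r \<longleftrightarrow>
    (\<exists>A B. consists_of_copies r
              (graph_join (complete_graph k) (graph_copies 2 (complete_graph 1))) A \<and>
           consists_of_copies (n - (k + 2) * r) (complete_graph 1) B \<and>
           A \<inter> B = {} \<and>
           obtained_by_proper_joins k (A \<union> B) G)"
proof
  assume m: "int (card (edges G)) = (int n - 1) * int k - int (k choose 2) * int r"
  obtain A B s t where D: "consists_of_copies s (K_minus_edge k) A"
    "consists_of_copies t (complete_graph 1) B" "A \<inter> B = {}" "n = (k + 2) * s + t"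
    "obtained_by_proper_joins k (A \<union> B) G"
    using k_edge_maximal_decomposition[OF assms(3)] assms(1,4) by auto
  have "int (k choose 2) * int r = int (k choose 2) * int s"
    using m edges_of_decomposition[OF D(1,2,3,5)] unfolding D(4)[symmetric] by linarith
  moreover have "k choose 2 \<noteq> 0" using assms(2) by simp
  ultimately have "s = r" by simp
  then show "\<exists>A B. consists_of_copies r (K_minus_edge k) A \<and>
      consists_of_copies (n - (k + 2) * r) (complete_graph 1) B \<and> A \<inter> B = {} \<and>
      obtained_by_proper_joins k (A \<union> B) G"
    using D by auto
next
  assume "\<exists>A B. consists_of_copies r (K_minus_edge k) A \<and>
      consists_of_copies (n - (k + 2) * r) (complete_graph 1) B \<and> A \<inter> B = {} \<and>
      obtained_by_proper_joins k (A \<union> B) G"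
  then obtain A B where D: "consists_of_copies r (K_minus_edge k) A"
    "consists_of_copies (n - (k + 2) * r) (complete_graph 1) B" "A \<inter> B = {}"
    "obtained_by_proper_joins k (A \<union> B) G" by blast
  have "(k + 2) * r \<le> n"
    using assms(6) by (metis less_eq_div_iff_mult_less_eq mult.commute zero_less_Suc add_2_eq_Suc')
  then show "int (card (edges G)) = (int n - 1) * int k - int (k choose 2) * int r"
    using edges_of_decomposition[OF D] by simp
qed

end
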